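(* Let $\mathcal{R}$ be a unital ring with involution in which $2$ is invertible, let $m\in\mathcal{R}$ be invertible with $m^*=m$, and let $a,b\in\mathcal{R}^{\mathrm{core},m}$. If $b\,a^{\mathrm{core},m}a=a$, then $a+b\in\mathcal{R}^{\mathrm{core},m}$ and $$(a+b)^{\mathrm{core},m}=-\tfrac12 a^{\mathrm{core},m}+b^{\mathrm{core},m}+\tfrac12 a^{\mathrm{core},m}b\,b^{\mathrm{core},m}-\tfrac12 a^{\mathrm{core},m}a\,b^{\mathrm{core},m}.$$
   Context: $\mathcal{R}$ is a (not necessarily commutative) unital ring with an involution $x\mapsto x^*$ satisfying $(xy)^*=y^*x^*$, $(x+y)^*=x^*+y^*$, $(x^* )^*=x$. For an invertible $m\in\mathcal{R}$ with $m^*=m$, an element $z\in\mathcal{R}$ is the $m$-weighted core inverse of $a\in\mathcal{R}$ if $aza=a$, $z\mathcal{R}=a\mathcal{R}$ and $\mathcal{R}z=\mathcal{R}a^*m$. It is unique if it exists and is denoted $a^{\mathrm{core},m}$; $\mathcal{R}^{\mathrm{core},m}$ is the set of elements that have an $m$-weighted core inverse. *)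

theory Defs
  imports "HOL-Algebra.Algebra"
begin

text \<open>
  The locale \<^locale>\<open>ring\<close> gives unital, not necessarily commutative rings; the zero ring is allowed.
\<close>

locale involutive_ring = ring R for R (structure) +
  fixes star :: "'a \<Rightarrow> 'a"
  assumes star_closed: "x \<in> carrier R \<Longrightarrow> star x \<in> carrier R"
    and star_mult: "\<lbrakk>x \<in> carrier R; y \<in> carrier R\<rbrakk> \<Longrightarrow> star (x \<otimes> y) = star y \<otimes> star x"
    and star_add: "\<lbrakk>x \<in> carrier R; y \<in> carrier R\<rbrakk> \<Longrightarrow> star (x \<oplus> y) = star x \<oplus> star y"
    and star_star: "x \<in> carrier R \<Longrightarrow> star (star x) = x"

text \<open>
  The principal one-sided ideals \<open>z R\<close> and \<open>R z\<close> are written with the library's multiplicative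
  cosets, which are defined for arbitrary subsets of a monoid: \<open>z <# carrier R = {z \<otimes> x | x \<in> carrier R}\<close>
  and \<open>carrier R #> z = {x \<otimes> z | x \<in> carrier R}\<close>.
\<close>

definition is_wcore_inverse ::
    "('a, 'b) ring_scheme \<Rightarrow> ('a \<Rightarrow> 'a) \<Rightarrow> 'a \<Rightarrow> 'a \<Rightarrow> 'a \<Rightarrow> bool" where
  "is_wcore_inverse R star m a z \<longleftrightarrow>
     z \<in> carrier R \<and>
     a \<otimes>\<^bsub>R\<^esub> z \<otimes>\<^bsub>R\<^esub> a = a \<and>
     z <#\<^bsub>R\<^esub> carrier R = a <#\<^bsub>R\<^esub> carrier R \<and>
     carrier R #>\<^bsub>R\<^esub> z = carrier R #>\<^bsub>R\<^esub> (star a \<otimes>\<^bsub>R\<^esub> m)"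

definition wcore_invertible ::
    "('a, 'b) ring_scheme \<Rightarrow> ('a \<Rightarrow> 'a) \<Rightarrow> 'a \<Rightarrow> 'a set" where
  "wcore_invertible R star m = {a \<in> carrier R. \<exists>z. is_wcore_inverse R star m a z}"

text \<open>
  Meaningful for \<open>a \<in> wcore_invertible R star m\<close> with \<open>m\<close> a self-adjoint unit, where the
  inverse is unique.
\<close>

definition wcore_inverse ::
    "('a, 'b) ring_scheme \<Rightarrow> ('a \<Rightarrow> 'a) \<Rightarrow> 'a \<Rightarrow> 'a \<Rightarrow> 'a" where
  "wcore_inverse R star m a = (THE z. is_wcore_inverse R star m a z)"

end

theory Submission
  imports Defs
begin

text \<open>
  Write \<open>x\<close>, \<open>y\<close> for the \<open>m\<close>-weighted core inverses of \<open>a\<close>, \<open>b\<close>. Two reductions make the formula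
  transparent.

  First, the ideal-theoretic definition is equivalent to three equations:
  \<open>z a a = a\<close>, \<open>a z z = z\<close>, and \<open>m a z\<close> is self-adjoint (\<open>is_wcore_inverse_iff\<close>). Thus \<open>a z\<close> is the
  idempotent onto \<open>a R\<close> that is orthogonal for the form given by \<open>m\<close>, and such an idempotent is
  determined by its range; this gives uniqueness.

  Secondly, \<open>x R = a R\<close> turns \<open>b x a = a\<close> into \<open>b x = a x\<close> and \<open>b a = a a\<close>: the elements \<open>a\<close> and
  \<open>b\<close> act alike on \<open>a R\<close>, and \<open>a R\<close> is contained in \<open>b R\<close>. Hence the orthogonal idempotents satisfy
  \<open>(b y)(a x) = a x\<close>, and taking adjoints \<open>(a x)(b y) = a x\<close>, so that \<open>x b y = x\<close>. The first and third
  summands of the claimed inverse therefore cancel, leaving \<open>z = y - w\<close> with \<open>w + w = x a y\<close>.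
  Since \<open>(a + b) w = a y\<close>, one gets \<open>(a + b) z = b y\<close>, the orthogonal idempotent that belongs to \<open>b\<close>.
  Two of the three equations are then immediate. The last one, \<open>z (a + b) (a + b) = a + b\<close>, is checked
  separately on \<open>a\<close> and on \<open>b\<close>, using \<open>y a = x a\<close>. Occurrences of one half are removed
  by doubling both sides.
\<close>

section \<open>Self-adjoint weights\<close>

context involutive_ring
begin

lemma star_one: "star \<one> = \<one>"
  using star_mult[of "star \<one>" \<one>] star_closed[of \<one>] star_star[of \<one>] by simp

lemma star_inv_self_adjoint:
  assumes m: "m \<in> Units R" "star m = m"
  shows "star (inv m) = inv m"
proof -
  have c: "m \<in> carrier R" "inv m \<in> carrier R" using m by auto
  have "m \<otimes> star (inv m) = \<one>"
    using star_mult[of "inv m" m] c m by (simp add: star_one)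
  then show ?thesis
    using inv_unique[of "inv m" m "star (inv m)"] c m star_closed by simp
qed

text \<open>
  The map \<open>p \<mapsto> m\<^sup>-\<^sup>1 p\<^sup>* m\<close> is an anti-automorphism, and the hypotheses say that it fixes
  \<open>p\<close>, \<open>q\<close> and \<open>r\<close>; apply it to \<open>q p = r\<close>. This is how an inclusion of ranges of orthogonal
  idempotents gives the products in both orders.
\<close>

lemma weighted_self_adjoint_mult_swap:
  assumes m: "m \<in> Units R" "star m = m"
    and c: "p \<in> carrier R" "q \<in> carrier R" "r \<in> carrier R"
    and sa: "star (m \<otimes> p) = m \<otimes> p" "star (m \<otimes> q) = m \<otimes> q" "star (m \<otimes> r) = m \<otimes> r"
    and qp: "q \<otimes> p = r"
  shows "p \<otimes> q = r"
proof -
  have mc: "m \<in> carrier R" using m by auto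
  note cl = mc c star_closed
  have sp: "star p \<otimes> m = m \<otimes> p" and sq: "star q \<otimes> m = m \<otimes> q" and sr: "star r \<otimes> m = m \<otimes> r"
    using sa cl m by (simp_all add: star_mult)
  have "m \<otimes> (p \<otimes> q) = star p \<otimes> m \<otimes> q" using cl by (simp add: sp m_assoc)
  also have "\<dots> = star p \<otimes> (star q \<otimes> m)" using cl by (simp add: sq m_assoc)
  also have "\<dots> = star (q \<otimes> p) \<otimes> m" using cl by (simp add: star_mult m_assoc)
  also have "\<dots> = m \<otimes> r" using sr qp by simp
  finally show ?thesis using Units_l_cancel[of m "p \<otimes> q" r] m cl by simp
qed

section \<open>Weighted core inverses by equations\<close>

lemma core_equations_inner:
  assumes c: "a \<in> carrier R" "z \<in> carrier R"
    and zaa: "z \<otimes> a \<otimes> a = a" and azz: "a \<otimes> z \<otimes> z = z"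
  shows "a \<otimes> z \<otimes> a = a"
proof -
  have "a \<otimes> z \<otimes> a = a \<otimes> z \<otimes> (z \<otimes> a \<otimes> a)" using zaa by simp
  also have "\<dots> = (a \<otimes> z \<otimes> z) \<otimes> a \<otimes> a" using c by (simp add: m_assoc)
  finally show ?thesis using zaa azz by simp
qed

lemma core_equations_outer:
  assumes c: "a \<in> carrier R" "z \<in> carrier R"
    and zaa: "z \<otimes> a \<otimes> a = a" and azz: "a \<otimes> z \<otimes> z = z"
  shows "z \<otimes> a \<otimes> z = z"
  using core_equations_inner[OF c(2,1) azz zaa] .

lemma mem_l_coset_self: "u \<in> carrier R \<Longrightarrow> u \<in> u <#\<^bsub>R\<^esub> carrier R"
  by (auto simp: l_coset_def intro!: bexI[of _ \<one>])

lemma mem_r_coset_self: "u \<in> carrier R \<Longrightarrow> u \<in> carrier R #>\<^bsub>R\<^esub> u"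
  by (auto simp: r_coset_def intro!: bexI[of _ \<one>])

lemma principal_right_ideal_subset:
  assumes "u \<in> carrier R" "v \<in> carrier R"
  shows "u \<otimes> v <#\<^bsub>R\<^esub> carrier R \<subseteq> u <#\<^bsub>R\<^esub> carrier R"
  unfolding l_coset_def using assms by (auto simp: m_assoc)

lemma principal_left_ideal_subset:
  assumes "u \<in> carrier R" "v \<in> carrier R"
  shows "carrier R #>\<^bsub>R\<^esub> (u \<otimes> v) \<subseteq> carrier R #>\<^bsub>R\<^esub> v"
  unfolding r_coset_def using assms by (auto simp: m_assoc[symmetric])

text \<open>
  For the forward direction, \<open>z \<in> R a\<^sup>* m\<close> and \<open>a\<^sup>* = a\<^sup>* (a z)\<^sup>*\<close> yield \<open>z = z m\<^sup>-\<^sup>1 (a z)\<^sup>* m\<close>. Multiplying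
  by \<open>a\<close> on the left shows that \<open>a z m\<^sup>-\<^sup>1\<close> has the form \<open>p m\<^sup>-\<^sup>1 p\<^sup>*\<close> with \<open>p = a z\<close>, hence is self-adjoint,
  and then so is \<open>m a z\<close>. The same formula also gives \<open>z a z = z\<close>.
\<close>

lemma is_wcore_inverse_iff:
  assumes m: "m \<in> Units R" "star m = m" and ac: "a \<in> carrier R"
  shows "is_wcore_inverse R star m a z \<longleftrightarrow>
    z \<in> carrier R \<and> z \<otimes> a \<otimes> a = a \<and> a \<otimes> z \<otimes> z = z \<and> star (m \<otimes> (a \<otimes> z)) = m \<otimes> (a \<otimes> z)"
    (is "?L \<longleftrightarrow> ?E")
proof
  let ?n = "inv m"
  have mc: "m \<in> carrier R" "?n \<in> carrier R" using m by auto
  have mn: "m \<otimes> ?n = \<one>" "?n \<otimes> m = \<one>" using m by auto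
  have mn': "m \<otimes> (?n \<otimes> t) = t" "?n \<otimes> (m \<otimes> t) = t" if "t \<in> carrier R" for t
    using that mc mn by (simp_all add: m_assoc[symmetric])
  {
    assume L: ?L
    have zc: "z \<in> carrier R" and aza: "a \<otimes> z \<otimes> a = a"
      and right: "z <#\<^bsub>R\<^esub> carrier R = a <#\<^bsub>R\<^esub> carrier R"
      and left: "carrier R #>\<^bsub>R\<^esub> z = carrier R #>\<^bsub>R\<^esub> (star a \<otimes> m)"
      using L by (auto simp: is_wcore_inverse_def)
    note cl = ac zc mc star_closed
    have "z \<in> a <#\<^bsub>R\<^esub> carrier R" using mem_l_coset_self[OF zc] right by simp
    then obtain u where u: "u \<in> carrier R" "z = a \<otimes> u" unfolding l_coset_def by auto
    have "a \<in> z <#\<^bsub>R\<^esub> carrier R" using mem_l_coset_self[OF ac] right by simp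
    then obtain v where v: "v \<in> carrier R" "a = z \<otimes> v" unfolding l_coset_def by auto
    have "z \<in> carrier R #>\<^bsub>R\<^esub> (star a \<otimes> m)" using mem_r_coset_self[OF zc] left by simp
    then obtain s where s: "s \<in> carrier R" "z = s \<otimes> (star a \<otimes> m)" unfolding r_coset_def by auto
    define p where "p = a \<otimes> z"
    have pc: "p \<in> carrier R" using cl by (simp add: p_def)
    have "p \<otimes> (a \<otimes> u) = a \<otimes> u"
      using aza pc cl u(1) by (simp add: p_def m_assoc[symmetric])
    then have azz: "a \<otimes> z \<otimes> z = z" using u(2) by (simp add: p_def)
    have "star a = star a \<otimes> star p"
      using arg_cong[OF aza, of star] cl pc by (simp add: p_def[symmetric] star_mult)
    then have "z = s \<otimes> (star a \<otimes> star p \<otimes> m)" using s(2) by metis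
    also have "\<dots> = s \<otimes> (star a \<otimes> m) \<otimes> (?n \<otimes> (star p \<otimes> m))"
      using cl s(1) pc mn' by (simp add: m_assoc)
    finally have zp: "z = z \<otimes> (?n \<otimes> (star p \<otimes> m))" by (simp only: s(2)[symmetric])
    have "p \<otimes> ?n = a \<otimes> (z \<otimes> (?n \<otimes> (star p \<otimes> m))) \<otimes> ?n"
      using arg_cong[OF zp, of "\<lambda>t. a \<otimes> t \<otimes> ?n"] by (simp only: p_def)
    also have "\<dots> = p \<otimes> ?n \<otimes> star p"
      using cl pc mn by (simp add: p_def m_assoc)
    finally have pn: "p \<otimes> ?n = p \<otimes> ?n \<otimes> star p" .
    have "star (p \<otimes> ?n \<otimes> star p) = p \<otimes> ?n \<otimes> star p"
      using cl pc by (simp add: star_mult star_star star_inv_self_adjoint[OF m] m_assoc)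
    then have "star (p \<otimes> ?n) = p \<otimes> ?n" by (simp only: pn[symmetric])
    then have np: "?n \<otimes> star p = p \<otimes> ?n"
      using cl pc by (simp add: star_mult star_inv_self_adjoint[OF m])
    have npm: "?n \<otimes> (star p \<otimes> m) = p"
      using np cl pc mn by (simp add: m_assoc[symmetric]) (simp add: m_assoc)
    have "star p \<otimes> m = m \<otimes> p"
      using mn'(1)[of "star p \<otimes> m"] npm cl pc by simp
    then have sa: "star (m \<otimes> p) = m \<otimes> p" using cl pc m by (simp add: star_mult)
    have "z \<otimes> p = z" using zp by (simp only: npm)
    then have "z \<otimes> a \<otimes> z = z" using cl by (simp add: p_def m_assoc)
    then have "z \<otimes> a \<otimes> (z \<otimes> v) = z \<otimes> v"
      using cl v(1) by (simp add: m_assoc[symmetric])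
    then have "z \<otimes> a \<otimes> a = a" using v(2) by simp
    then show ?E using zc azz sa by (simp add: p_def)
  next
    assume E: ?E
    then have zc: "z \<in> carrier R" and zaa: "z \<otimes> a \<otimes> a = a" and azz: "a \<otimes> z \<otimes> z = z"
      and sa: "star (m \<otimes> (a \<otimes> z)) = m \<otimes> (a \<otimes> z)" by auto
    note cl = ac zc mc star_closed
    have aza: "a \<otimes> z \<otimes> a = a" and zaz: "z \<otimes> a \<otimes> z = z"
      using core_equations_inner core_equations_outer ac zc zaa azz by blast+
    have sp: "star z \<otimes> star a \<otimes> m = m \<otimes> (a \<otimes> z)"
      using sa cl m by (simp add: star_mult)
    have right: "z <#\<^bsub>R\<^esub> carrier R = a <#\<^bsub>R\<^esub> carrier R"
      using principal_right_ideal_subset[of a "z \<otimes> z"] principal_right_ideal_subset[of z "a \<otimes> a"]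
        cl zaa azz by (auto simp: m_assoc)
    have "z \<otimes> (?n \<otimes> (m \<otimes> (a \<otimes> z))) = z" using zaz cl mn' by (simp add: m_assoc)
    then have "z = z \<otimes> (?n \<otimes> (m \<otimes> (a \<otimes> z)))" by (rule sym)
    also have "\<dots> = (z \<otimes> ?n \<otimes> star z) \<otimes> (star a \<otimes> m)"
      unfolding sp[symmetric] using cl by (simp add: m_assoc)
    finally have z: "z = (z \<otimes> ?n \<otimes> star z) \<otimes> (star a \<otimes> m)" .
    have "star a \<otimes> m = star (a \<otimes> z \<otimes> a) \<otimes> m" by (simp only: aza)
    also have "\<dots> = star a \<otimes> (star z \<otimes> star a \<otimes> m)"
      using cl by (simp add: star_mult m_assoc)
    also have "\<dots> = (star a \<otimes> m \<otimes> a) \<otimes> z"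
      unfolding sp using cl by (simp add: m_assoc)
    finally have am: "star a \<otimes> m = (star a \<otimes> m \<otimes> a) \<otimes> z" .
    have "carrier R #>\<^bsub>R\<^esub> z = carrier R #>\<^bsub>R\<^esub> (star a \<otimes> m)"
      using principal_left_ideal_subset[of "z \<otimes> ?n \<otimes> star z" "star a \<otimes> m"]
        principal_left_ideal_subset[of "star a \<otimes> m \<otimes> a" z] cl
      unfolding z[symmetric] am[symmetric] by simp
    then show ?L using zc aza right by (simp add: is_wcore_inverse_def)
  }
qed

text \<open>
  If \<open>z\<close> and \<open>w\<close> are both core inverses, then \<open>a z = a w\<close>, because these orthogonal idempotents have
  the same range \<open>a R\<close>. As \<open>z a\<close> fixes \<open>a R\<close>, which contains \<open>w\<close>, it follows that
  \<open>z = z a z = z a w = w\<close>.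
\<close>

lemma is_wcore_inverse_unique:
  assumes m: "m \<in> Units R" "star m = m" and ac: "a \<in> carrier R"
    and z: "is_wcore_inverse R star m a z" and w: "is_wcore_inverse R star m a w"
  shows "z = w"
proof -
  have zE: "z \<in> carrier R" "z \<otimes> a \<otimes> a = a" "a \<otimes> z \<otimes> z = z"
      "star (m \<otimes> (a \<otimes> z)) = m \<otimes> (a \<otimes> z)"
    and wE: "w \<in> carrier R" "w \<otimes> a \<otimes> a = a" "a \<otimes> w \<otimes> w = w"
      "star (m \<otimes> (a \<otimes> w)) = m \<otimes> (a \<otimes> w)"
    using z w is_wcore_inverse_iff[OF m ac] by auto
  note cl = ac zE(1) wE(1)
  have aza: "a \<otimes> z \<otimes> a = a" and awa: "a \<otimes> w \<otimes> a = a"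
    using core_equations_inner ac zE wE by blast+
  have "a \<otimes> w \<otimes> (a \<otimes> z) = a \<otimes> z" using awa cl by (simp add: m_assoc[symmetric])
  then have "a \<otimes> z \<otimes> (a \<otimes> w) = a \<otimes> z"
    using weighted_self_adjoint_mult_swap[OF m _ _ _ zE(4) wE(4) zE(4)] cl by blast
  then have eq: "a \<otimes> w = a \<otimes> z" using aza cl by (simp add: m_assoc[symmetric])
  have "z = z \<otimes> a \<otimes> z" using core_equations_outer ac zE by metis
  also have "\<dots> = z \<otimes> a \<otimes> w" using eq cl by (simp add: m_assoc)
  also have "\<dots> = z \<otimes> a \<otimes> (a \<otimes> w \<otimes> w)" using wE by simp
  also have "\<dots> = (z \<otimes> a \<otimes> a) \<otimes> w \<otimes> w" using cl by (simp add: m_assoc)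
  also have "\<dots> = w" using zE wE by simp
  finally show ?thesis .
qed

lemma wcore_inverse_eq:
  assumes "m \<in> Units R" "star m = m" "a \<in> carrier R" "is_wcore_inverse R star m a z"
  shows "wcore_inverse R star m a = z"
  unfolding wcore_inverse_def using assms is_wcore_inverse_unique by blast

section \<open>The sum of two core invertible elements\<close>

lemma double_cancel:
  assumes two: "\<one> \<oplus> \<one> \<in> Units R" and c: "u \<in> carrier R" "v \<in> carrier R"
    and eq: "u \<oplus> u = v \<oplus> v"
  shows "u = v"
proof -
  have "(\<one> \<oplus> \<one>) \<otimes> u = (\<one> \<oplus> \<one>) \<otimes> v" using eq c by (simp add: l_distr)
  then show ?thesis using Units_l_cancel[OF two] c by simp
qed

lemma double_half:
  assumes two: "\<one> \<oplus> \<one> \<in> Units R" and c: "u \<in> carrier R"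
  shows "inv (\<one> \<oplus> \<one>) \<otimes> u \<oplus> inv (\<one> \<oplus> \<one>) \<otimes> u = u"
proof -
  have h: "inv (\<one> \<oplus> \<one>) \<in> carrier R" using two by simp
  have "inv (\<one> \<oplus> \<one>) \<otimes> u \<oplus> inv (\<one> \<oplus> \<one>) \<otimes> u = (\<one> \<oplus> \<one>) \<otimes> (inv (\<one> \<oplus> \<one>) \<otimes> u)"
    using h c by (simp add: l_distr)
  also have "\<dots> = u" using two h c by (simp add: m_assoc[symmetric])
  finally show ?thesis .
qed

text \<open>
  The hypothesis \<open>b x a = a\<close> puts \<open>a R = x R\<close> inside \<open>b R\<close>, where \<open>y b\<close> (by \<open>y b b = b\<close>) and \<open>b y\<close> (by
  \<open>b y b = b\<close>) act as the identity from the left. The last relation is of a different kind: it is the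
  one that needs the adjoint, which swaps the factors in \<open>(b y)(a x) = a x\<close>.
\<close>

lemma absorption_relations:
  assumes m: "m \<in> Units R" "star m = m" and c: "a \<in> carrier R" "b \<in> carrier R"
    and x: "is_wcore_inverse R star m a x" and y: "is_wcore_inverse R star m b y"
    and bxa: "b \<otimes> x \<otimes> a = a"
  shows "b \<otimes> y \<otimes> a = a" "b \<otimes> y \<otimes> x = x" "y \<otimes> b \<otimes> a = a" "y \<otimes> a = x \<otimes> a" "x \<otimes> b \<otimes> y = x"
proof -
  have xE: "x \<in> carrier R" "x \<otimes> a \<otimes> a = a" "a \<otimes> x \<otimes> x = x"
      "star (m \<otimes> (a \<otimes> x)) = m \<otimes> (a \<otimes> x)"
    and yE: "y \<in> carrier R" "y \<otimes> b \<otimes> b = b" "b \<otimes> y \<otimes> y = y"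
      "star (m \<otimes> (b \<otimes> y)) = m \<otimes> (b \<otimes> y)"
    using x y is_wcore_inverse_iff[OF m] c by auto
  note cl = c xE(1) yE(1)
  have xax: "x \<otimes> a \<otimes> x = x" and byb: "b \<otimes> y \<otimes> b = b"
    using core_equations_outer core_equations_inner c xE yE by blast+
  have "b \<otimes> y \<otimes> (b \<otimes> x \<otimes> a) = b \<otimes> x \<otimes> a"
    using byb cl by (simp add: m_assoc[symmetric])
  then show bya: "b \<otimes> y \<otimes> a = a" using bxa by simp
  have "b \<otimes> y \<otimes> (a \<otimes> x \<otimes> x) = a \<otimes> x \<otimes> x"
    using bya cl by (simp add: m_assoc[symmetric])
  then show "b \<otimes> y \<otimes> x = x" using xE(3) by simp
  have "y \<otimes> b \<otimes> (b \<otimes> x \<otimes> a) = b \<otimes> x \<otimes> a"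
    using yE(2) cl by (simp add: m_assoc[symmetric])
  then show yba: "y \<otimes> b \<otimes> a = a" using bxa by simp
  have "y \<otimes> b \<otimes> (a \<otimes> x \<otimes> x) = a \<otimes> x \<otimes> x"
    using yba cl by (simp add: m_assoc[symmetric])
  then have ybx: "y \<otimes> b \<otimes> x = x" using xE(3) by simp
  have "y \<otimes> a = y \<otimes> (b \<otimes> x \<otimes> a)" using bxa by simp
  also have "\<dots> = x \<otimes> a" using ybx cl by (simp add: m_assoc[symmetric])
  finally show "y \<otimes> a = x \<otimes> a" .
  have "b \<otimes> y \<otimes> (a \<otimes> x) = a \<otimes> x" using bya cl by (simp add: m_assoc[symmetric])
  then have pq: "a \<otimes> x \<otimes> (b \<otimes> y) = a \<otimes> x"
    using weighted_self_adjoint_mult_swap[OF m _ _ _ xE(4) yE(4) xE(4)] cl by blast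
  have "x \<otimes> b \<otimes> y = x \<otimes> a \<otimes> x \<otimes> (b \<otimes> y)" using xax cl by (simp add: m_assoc)
  also have "\<dots> = x \<otimes> (a \<otimes> x \<otimes> (b \<otimes> y))" using cl by (simp add: m_assoc)
  also have "\<dots> = x" using pq xax cl by (simp add: m_assoc)
  finally show "x \<otimes> b \<otimes> y = x" .
qed

text \<open>
  The core inverse of \<open>a + b\<close> in simplified form. The element \<open>w\<close> is half of \<open>x a y\<close>; the products with
  \<open>w\<close> are computed from their doubles. Since \<open>(a + b) (y - w) = b y\<close>, the orthogonal
  idempotent of \<open>a + b\<close> is that of \<open>b\<close>.
\<close>

lemma is_wcore_inverse_add:
  assumes m: "m \<in> Units R" "star m = m" and two: "\<one> \<oplus> \<one> \<in> Units R"
    and c: "a \<in> carrier R" "b \<in> carrier R"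
    and x: "is_wcore_inverse R star m a x" and y: "is_wcore_inverse R star m b y"
    and bxa: "b \<otimes> x \<otimes> a = a"
  shows "is_wcore_inverse R star m (a \<oplus> b) (y \<ominus> inv (\<one> \<oplus> \<one>) \<otimes> (x \<otimes> a \<otimes> y))"
proof -
  have xE: "x \<in> carrier R" "x \<otimes> a \<otimes> a = a" "a \<otimes> x \<otimes> x = x"
    and yE: "y \<in> carrier R" "y \<otimes> b \<otimes> b = b" "b \<otimes> y \<otimes> y = y"
      "star (m \<otimes> (b \<otimes> y)) = m \<otimes> (b \<otimes> y)"
    using x y is_wcore_inverse_iff[OF m] c by auto
  note rel = absorption_relations[OF m c x y bxa]
  have axa: "a \<otimes> x \<otimes> a = a" and xax: "x \<otimes> a \<otimes> x = x" and byb: "b \<otimes> y \<otimes> b = b"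
    using core_equations_inner core_equations_outer c xE yE by blast+
  define w where "w = inv (\<one> \<oplus> \<one>) \<otimes> (x \<otimes> a \<otimes> y)"
  have wc: "w \<in> carrier R" using two c xE(1) yE(1) by (simp add: w_def)
  have ww: "w \<oplus> w = x \<otimes> a \<otimes> y" unfolding w_def using double_half[OF two] c xE(1) yE(1) by simp
  note cl = c xE(1) yE(1) wc
  let ?c = "a \<oplus> b"
  let ?z = "y \<ominus> w"
  have cc: "?c \<in> carrier R" "?z \<in> carrier R" using cl by auto
  have "?c \<otimes> w \<oplus> ?c \<otimes> w = ?c \<otimes> (w \<oplus> w)" using cl by (simp add: r_distr)
  also have "\<dots> = (a \<otimes> x \<otimes> a) \<otimes> y \<oplus> (b \<otimes> x \<otimes> a) \<otimes> y"
    unfolding ww using cl by (simp add: l_distr m_assoc)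
  finally have cw: "?c \<otimes> w = a \<otimes> y"
    using double_cancel[OF two, of "?c \<otimes> w" "a \<otimes> y"] axa bxa cl by simp
  have "?c \<otimes> ?z = ?c \<otimes> y \<ominus> ?c \<otimes> w"
    using cl by (simp add: minus_eq r_distr r_minus)
  also have "\<dots> = (a \<otimes> y \<oplus> b \<otimes> y) \<ominus> a \<otimes> y" unfolding cw using cl by (simp add: l_distr)
  also have "\<dots> = b \<otimes> y" using cl by algebra
  finally have cz: "?c \<otimes> ?z = b \<otimes> y" .
  have "b \<otimes> y \<otimes> w \<oplus> b \<otimes> y \<otimes> w = b \<otimes> y \<otimes> (w \<oplus> w)" using cl by (simp add: r_distr)
  also have "\<dots> = (b \<otimes> y \<otimes> x) \<otimes> a \<otimes> y" unfolding ww using cl by (simp add: m_assoc)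
  also have "\<dots> = w \<oplus> w" unfolding rel(2) ww ..
  finally have byw: "b \<otimes> y \<otimes> w = w"
    using double_cancel[OF two, of "b \<otimes> y \<otimes> w" w] cl by blast
  have "?c \<otimes> ?z \<otimes> ?z = b \<otimes> y \<otimes> y \<ominus> b \<otimes> y \<otimes> w"
    unfolding cz using cl by (simp add: minus_eq r_distr r_minus)
  then have czz: "?c \<otimes> ?z \<otimes> ?z = ?z" using yE(3) byw by simp
  have yc: "y \<otimes> ?c = x \<otimes> a \<oplus> y \<otimes> b" using rel(4) cl by (simp add: r_distr)
  have yca: "y \<otimes> ?c \<otimes> a = a \<oplus> a" unfolding yc using xE(2) rel(3) cl by (simp add: l_distr)
  have ycb: "y \<otimes> ?c \<otimes> b = x \<otimes> a \<otimes> b \<oplus> b" unfolding yc using yE(2) cl by (simp add: l_distr)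
  \<comment> \<open>Reduces the products with \<open>w\<close> to those with \<open>y\<close>, which are known for \<open>s = a\<close> and \<open>s = b\<close>.\<close>
  have wcs: "w \<otimes> ?c \<otimes> s \<oplus> w \<otimes> ?c \<otimes> s = x \<otimes> a \<otimes> (y \<otimes> ?c \<otimes> s)" if "s \<in> carrier R" for s
  proof -
    have "w \<otimes> ?c \<otimes> s \<oplus> w \<otimes> ?c \<otimes> s = (w \<oplus> w) \<otimes> (?c \<otimes> s)"
      using that cl cc(1) l_distr[of w w "?c \<otimes> s"] by (simp add: m_assoc)
    also have "\<dots> = x \<otimes> a \<otimes> (y \<otimes> ?c \<otimes> s)"
      unfolding ww using that cl cc(1) by (simp add: m_assoc)
    finally show ?thesis .
  qed
  have "x \<otimes> a \<otimes> (a \<oplus> a) = a \<oplus> a" using xE(2) cl by (simp add: r_distr)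
  then have wca: "w \<otimes> ?c \<otimes> a = a"
    using double_cancel[OF two, of "w \<otimes> ?c \<otimes> a" a] wcs[of a] yca cl by simp
  have "x \<otimes> a \<otimes> (x \<otimes> a \<otimes> b \<oplus> b) = (x \<otimes> a \<otimes> x) \<otimes> a \<otimes> b \<oplus> x \<otimes> a \<otimes> b"
    using cl by (simp add: r_distr m_assoc)
  then have wcb: "w \<otimes> ?c \<otimes> b = x \<otimes> a \<otimes> b"
    using double_cancel[OF two, of "w \<otimes> ?c \<otimes> b" "x \<otimes> a \<otimes> b"] wcs[of b] ycb xax cl by simp
  have zcs: "?z \<otimes> ?c \<otimes> s = y \<otimes> ?c \<otimes> s \<ominus> w \<otimes> ?c \<otimes> s" if "s \<in> carrier R" for s
    using that cl cc(1) l_distr[of y "\<ominus> w" ?c] by (simp add: minus_eq l_distr l_minus)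
  have zca: "?z \<otimes> ?c \<otimes> a = a" unfolding zcs[OF c(1)] yca wca using cl by algebra
  have zcb: "?z \<otimes> ?c \<otimes> b = b" unfolding zcs[OF c(2)] ycb wcb
    using m_closed[OF m_closed[OF xE(1) c(1)] c(2)] c(2) by algebra
  have "?z \<otimes> ?c \<otimes> ?c = ?z \<otimes> ?c \<otimes> a \<oplus> ?z \<otimes> ?c \<otimes> b"
    using r_distr[OF c m_closed[OF cc(2,1)]] by simp
  then have zcc: "?z \<otimes> ?c \<otimes> ?c = ?c" using zca zcb by simp
  show ?thesis
    using is_wcore_inverse_iff[OF m cc(1)] cc(2) zcc czz cz yE(4) unfolding w_def by simp
qed

end

theorem theorem3p7:
  fixes R (structure) and star :: "'a \<Rightarrow> 'a" and m a b :: 'a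
  assumes "involutive_ring R star"
    and "\<one> \<oplus> \<one> \<in> Units R"
    and "m \<in> Units R" and "star m = m"
    and "a \<in> wcore_invertible R star m" and "b \<in> wcore_invertible R star m"
    and "b \<otimes> wcore_inverse R star m a \<otimes> a = a"
  shows "a \<oplus> b \<in> wcore_invertible R star m \<and>
    wcore_inverse R star m (a \<oplus> b) =
      \<ominus> (inv (\<one> \<oplus> \<one>) \<otimes> wcore_inverse R star m a)
      \<oplus> wcore_inverse R star m b
      \<oplus> inv (\<one> \<oplus> \<one>) \<otimes> (wcore_inverse R star m a \<otimes> b \<otimes> wcore_inverse R star m b)
      \<ominus> inv (\<one> \<oplus> \<one>) \<otimes> (wcore_inverse R star m a \<otimes> a \<otimes> wcore_inverse R star m b)"
proof -
  interpret involutive_ring R star by fact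
  note two = assms(2) and m = assms(3,4)
  obtain x y where ac: "a \<in> carrier R" and x: "is_wcore_inverse R star m a x"
    and bc: "b \<in> carrier R" and y: "is_wcore_inverse R star m b y"
    using assms(5,6) unfolding wcore_invertible_def by blast
  have xeq: "wcore_inverse R star m a = x" and yeq: "wcore_inverse R star m b = y"
    using wcore_inverse_eq[OF m] ac bc x y by auto
  have bxa: "b \<otimes> x \<otimes> a = a" using assms(7) xeq by simp
  have xc: "x \<in> carrier R" and yc: "y \<in> carrier R"
    using x y by (auto simp: is_wcore_inverse_def)
  have hc: "inv (\<one> \<oplus> \<one>) \<in> carrier R" using two by simp
  let ?h = "inv (\<one> \<oplus> \<one>)"
  let ?w = "?h \<otimes> (x \<otimes> a \<otimes> y)"
  have core: "is_wcore_inverse R star m (a \<oplus> b) (y \<ominus> ?w)"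
    using is_wcore_inverse_add[OF m two ac bc x y bxa] .
  have hx: "?h \<otimes> x \<in> carrier R" and wc: "?w \<in> carrier R" using hc xc ac yc by auto
  have "\<ominus> (?h \<otimes> x) \<oplus> y \<oplus> ?h \<otimes> (x \<otimes> b \<otimes> y) \<ominus> ?w = \<ominus> (?h \<otimes> x) \<oplus> y \<oplus> ?h \<otimes> x \<ominus> ?w"
    using absorption_relations(5)[OF m ac bc x y bxa] by simp
  also have "\<dots> = y \<ominus> ?w" using hx wc yc by algebra
  finally have formula:
    "\<ominus> (?h \<otimes> x) \<oplus> y \<oplus> ?h \<otimes> (x \<otimes> b \<otimes> y) \<ominus> ?w = y \<ominus> ?w" .
  have "a \<oplus> b \<in> wcore_invertible R star m"
    using core ac bc unfolding wcore_invertible_def by auto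
  moreover have "wcore_inverse R star m (a \<oplus> b) = y \<ominus> ?w"
    using wcore_inverse_eq[OF m _ core] ac bc by simp
  ultimately show ?thesis unfolding xeq yeq formula by simp
qed

end
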